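(* Let $G$ be a graph that has a maximum open packing which induces a matching, and let $H$ be a graph that has at least one edge. Then $$\iota(G\times H)\ge \frac{\rho^o(G)}{2}\cdot\left\lceil\frac{2|E(H)|}{\Delta(H)^2}\right\rceil.$$
   Context: All graphs are finite, simple and undirected. The direct product $G\times H$ has vertex set $V(G)\times V(H)$, and $(g,h)$, $(g',h')$ are adjacent if and only if $gg'\in E(G)$ and $hh'\in E(H)$. $\Delta(H)$ is the maximum degree of $H$. A set $S\subseteq V(G)$ is an isolating set of $G$ if $V(G)-N_G[S]$ induces a graph with no edges, where $N_G[S]$ is the closed neighborhood of $S$; $\iota(G)$ is the minimum cardinality of an isolating set of $G$. A set $P\subseteq V(G)$ is an open packing if the open neighborhoods of its vertices are pairwise disjoint; $\rho^o(G)$ is the maximum cardinality of an open packing, and a maximum open packing is one of cardinality $\rho^o(G)$. A set $P$ induces a matching if the subgraph of $G$ induced by $P$ is $1$-regular (every vertex of $P$ has exactly one neighbor in $P$). *)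

theory Defs
  imports Complex_Main "Graph_Theory.Graph_Theory"
begin

text \<open>
  A finite simple undirected graph is a \<^locale>\<open>pair_graph\<close>: a finite symmetric loop-free
  digraph whose arcs are pairs. Each undirected edge is thus a pair of opposite arcs, and the
  degree of a vertex is its \<^const>\<open>out_degree\<close>.
\<close>

definition edges :: "'a pair_pre_digraph \<Rightarrow> 'a set set" where
  "edges G = {{u, v} | u v. (u, v) \<in> parcs G}"

definition max_degree :: "'a pair_pre_digraph \<Rightarrow> nat" where
  "max_degree G = Max (out_degree (with_proj G) ` pverts G)"

definition direct_product ::
    "'a pair_pre_digraph \<Rightarrow> 'b pair_pre_digraph \<Rightarrow> ('a \<times> 'b) pair_pre_digraph" where
  "direct_product G H =
    \<lparr> pverts = pverts G \<times> pverts H,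
      parcs = {((g, h), (g', h')) | g h g' h'. (g, g') \<in> parcs G \<and> (h, h') \<in> parcs H} \<rparr>"

definition open_neighborhood :: "'a pair_pre_digraph \<Rightarrow> 'a \<Rightarrow> 'a set" where
  "open_neighborhood G v = {u. (v, u) \<in> parcs G}"

definition closed_neighborhood :: "'a pair_pre_digraph \<Rightarrow> 'a set \<Rightarrow> 'a set" where
  "closed_neighborhood G S = S \<union> (\<Union>v\<in>S. open_neighborhood G v)"

definition isolating_set :: "'a pair_pre_digraph \<Rightarrow> 'a set \<Rightarrow> bool" where
  "isolating_set G S \<longleftrightarrow>
    S \<subseteq> pverts G \<and> arcs (with_proj G \<restriction> (pverts G - closed_neighborhood G S)) = {}"

definition isolation_number :: "'a pair_pre_digraph \<Rightarrow> nat" where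
  "isolation_number G = Min (card ` {S. isolating_set G S})"

definition open_packing :: "'a pair_pre_digraph \<Rightarrow> 'a set \<Rightarrow> bool" where
  "open_packing G P \<longleftrightarrow>
    P \<subseteq> pverts G \<and>
    (\<forall>u\<in>P. \<forall>v\<in>P. u \<noteq> v \<longrightarrow> open_neighborhood G u \<inter> open_neighborhood G v = {})"

definition open_packing_number :: "'a pair_pre_digraph \<Rightarrow> nat" where
  "open_packing_number G = Max (card ` {P. open_packing G P})"

definition maximum_open_packing :: "'a pair_pre_digraph \<Rightarrow> 'a set \<Rightarrow> bool" where
  "maximum_open_packing G P \<longleftrightarrow> open_packing G P \<and> card P = open_packing_number G"

definition induces_matching :: "'a pair_pre_digraph \<Rightarrow> 'a set \<Rightarrow> bool" where
  "induces_matching G P \<longleftrightarrow> (\<forall>v\<in>P. out_degree (with_proj G \<restriction> P) v = 1)"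

lemma pair_graph_direct_product:
  assumes "pair_graph G" and "pair_graph H"
  shows "pair_graph (direct_product G H)"
proof -
  interpret G: pair_graph G by fact
  interpret H: pair_graph H by fact
  have sub: "parcs (direct_product G H) \<subseteq> (pverts G \<times> pverts H) \<times> (pverts G \<times> pverts H)"
    using G.wellformed' H.wellformed' by (auto simp: direct_product_def)
  show ?thesis
  proof
    show "finite (pverts (direct_product G H))"
      by (simp add: direct_product_def)
    show "finite (parcs (direct_product G H))"
      by (rule finite_subset[OF sub]) simp
    show "symmetric (with_proj (direct_product G H))"
      using G.sym_arcs H.sym_arcs
      by (auto simp: direct_product_def symmetric_def sym_def)
  next
    fix e assume e: "e \<in> parcs (direct_product G H)"
    show "fst e \<in> pverts (direct_product G H)" "snd e \<in> pverts (direct_product G H)"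
      using e G.wellformed' H.wellformed' by (auto simp: direct_product_def)
    show "fst e \<noteq> snd e"
      using e G.pair_no_loops by (fastforce simp: direct_product_def)
  qed
qed

end

theory Submission
  imports Defs
begin

text \<open>
  Let \<open>P\<close> be a maximum open packing that induces a matching, let \<open>x \<in> P\<close> have partner
  \<open>y \<in> P\<close>, and let \<open>D\<close> be an isolating set of \<open>G \<times> H\<close>. Since \<open>xy\<close> is an edge of \<open>G\<close>, each
  of the \<open>2|E(H)|\<close> arcs \<open>(h, h')\<close> of \<open>H\<close> gives an edge between \<open>(x, h)\<close> and \<open>(y, h')\<close>,
  and \<open>D\<close> has to dominate an end of it. The dominating vertex lies in the part of \<open>D\<close> over
  \<open>N(x)\<close> or over \<open>N(y)\<close>, even when it is an end of the edge itself, as \<open>x \<in> N(y)\<close> and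
  \<open>y \<in> N(x)\<close>. A vertex \<open>(g, k)\<close> over \<open>N(x)\<close> deals only with arcs whose tail is one of the at
  most \<open>\<Delta>(H)\<close> neighbours of \<open>k\<close>, that is, with at most \<open>\<Delta>(H)\<^sup>2\<close> arcs; over \<open>N(y)\<close> the same
  holds with heads. Hence at least \<open>\<lceil>2|E(H)| / \<Delta>(H)\<^sup>2\<rceil>\<close> elements of \<open>D\<close> lie over \<open>N(x)\<close> or
  \<open>N(y)\<close> (\<open>matched_layers_bound\<close>).

  As \<open>P\<close> is an open packing, the parts of \<open>D\<close> over the neighbourhoods of different elements of
  \<open>P\<close> are disjoint. Adding the bound over all \<open>x \<in> P\<close> therefore counts every element of \<open>D\<close> at
  most twice, once for a vertex of \<open>P\<close> and once for its partner, which is where the factor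
  \<open>1/2\<close> comes from.
\<close>

lemma card_parcs_eq_twice_card_edges:
  assumes "pair_graph H"
  shows "card (parcs H) = 2 * card (edges H)"
proof -
  interpret H: pair_graph H by fact
  define ends where "ends = (\<lambda>a :: 'a \<times> 'a. {fst a, snd a})"
  have edges_image: "edges H = ends ` parcs H"
    unfolding edges_def ends_def by force
  have fibre: "card {a \<in> parcs H. ends a = e} = 2" if e: "e \<in> edges H" for e
  proof -
    obtain u v where uv: "(u, v) \<in> parcs H" "e = {u, v}"
      using e by (auto simp: edges_def)
    have "(v, u) \<in> parcs H"
      using uv(1) H.sym_arcs by (auto simp: symmetric_def sym_def)
    with uv have "{a \<in> parcs H. ends a = e} = {(u, v), (v, u)}"
      by (auto simp: ends_def doubleton_eq_iff)
    moreover have "u \<noteq> v"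
      using H.pair_no_loops[OF uv(1)] by simp
    ultimately show ?thesis by simp
  qed
  have "card (parcs H) = (\<Sum>e\<in>edges H. card {a \<in> parcs H. ends a = e})"
    using sum.image_gen[OF H.pair_finite_arcs, of "\<lambda>_. 1::nat" ends]
    by (simp add: edges_image)
  also have "\<dots> = 2 * card (edges H)"
    by (simp add: fibre)
  finally show ?thesis .
qed

lemma out_degree_eq_card_open_neighborhood:
  "out_degree (with_proj G) v = card (open_neighborhood G v)"
proof -
  have "out_arcs (with_proj G) v = Pair v ` open_neighborhood G v"
    by (auto simp: out_arcs_def open_neighborhood_def)
  then show ?thesis
    by (simp add: out_degree_def card_image inj_on_def)
qed

lemma (in pair_graph) open_neighborhood_sym:
  "u \<in> open_neighborhood G v \<longleftrightarrow> v \<in> open_neighborhood G u"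
  using sym_arcs by (auto simp: open_neighborhood_def symmetric_def sym_def)

lemma (in pair_graph) open_neighborhood_subset: "open_neighborhood G v \<subseteq> pverts G"
  using wellformed' by (auto simp: open_neighborhood_def)

lemma (in pair_graph) finite_open_neighborhood: "finite (open_neighborhood G v)"
  using open_neighborhood_subset by (rule finite_subset) simp

lemma (in pair_graph) card_open_neighborhood_le_max_degree:
  "card (open_neighborhood G v) \<le> max_degree G"
proof (cases "v \<in> pverts G")
  case True
  then show ?thesis
    unfolding max_degree_def out_degree_eq_card_open_neighborhood by simp
next
  case False
  then have "open_neighborhood G v = {}"
    using wellformed' by (auto simp: open_neighborhood_def)
  then show ?thesis by simp
qed

lemma (in pair_graph) card_walks_length_two_le:
  "card (Sigma (open_neighborhood G k) (open_neighborhood G)) \<le> (max_degree G)\<^sup>2"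
proof -
  have "card (Sigma (open_neighborhood G k) (open_neighborhood G)) =
      (\<Sum>a\<in>open_neighborhood G k. card (open_neighborhood G a))"
    by (simp add: finite_open_neighborhood)
  also have "\<dots> \<le> card (open_neighborhood G k) * max_degree G"
    by (rule sum_bounded_above[where 'a = nat, simplified])
      (rule card_open_neighborhood_le_max_degree)
  also have "\<dots> \<le> max_degree G * max_degree G"
    by (intro mult_right_mono card_open_neighborhood_le_max_degree) simp
  finally show ?thesis by (simp add: power2_eq_square)
qed

lemma isolating_set_meets_arc:
  assumes "pair_graph G" "isolating_set G S" "(u, v) \<in> parcs G"
  shows "u \<in> closed_neighborhood G S \<or> v \<in> closed_neighborhood G S"
proof -
  interpret pair_graph G by fact
  from assms(3) have "u \<in> pverts G" "v \<in> pverts G"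
    using wellformed' by auto
  with assms(2,3) show ?thesis
    by (auto simp: isolating_set_def)
qed

lemma isolation_number_attained:
  assumes "pair_graph G"
  obtains S where "isolating_set G S" "card S = isolation_number G"
proof -
  interpret pair_graph G by fact
  have "{S. isolating_set G S} \<subseteq> Pow (pverts G)"
    by (auto simp: isolating_set_def)
  then have fin: "finite {S. isolating_set G S}"
    by (rule finite_subset) simp
  have "isolating_set G (pverts G)"
    by (auto simp: isolating_set_def closed_neighborhood_def)
  then have "isolation_number G \<in> card ` {S. isolating_set G S}"
    unfolding isolation_number_def using fin by (intro Min_in) auto
  then show ?thesis
    using that by auto
qed

lemma induces_matching_ex1_partner:
  assumes "induces_matching G P" "x \<in> P"
  shows "\<exists>!y. y \<in> P \<and> y \<in> open_neighborhood G x"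
proof -
  have "out_arcs (with_proj G \<restriction> P) x = Pair x ` (P \<inter> open_neighborhood G x)"
    using assms(2) by (auto simp: out_arcs_def open_neighborhood_def)
  then have "card (P \<inter> open_neighborhood G x) = 1"
    using assms by (auto simp: induces_matching_def out_degree_def card_image inj_on_def)
  then obtain y where "P \<inter> open_neighborhood G x = {y}"
    by (rule card_1_singletonE)
  then show ?thesis
    by (intro ex1I[of _ y]) auto
qed

text \<open>
  The layers of \<open>D\<close> over \<open>N(x)\<close> and \<open>N(y)\<close> together have to cover all arcs of \<open>H\<close>. The vertices
  over \<open>N(x)\<close> are charged with the arcs that have a dominated tail, the vertices over \<open>N(y)\<close>
  with the arcs that have a dominated head. It is this asymmetry that makes arcs, rather than
  edges, the natural objects to count.
\<close>

lemma matched_layers_bound: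
  assumes "pair_graph G" "pair_graph H"
    and D: "isolating_set (direct_product G H) D" "finite D"
    and xy: "(x, y) \<in> parcs G"
  shows "2 * card (edges H) \<le>
    (card (D \<inter> open_neighborhood G x \<times> UNIV) + card (D \<inter> open_neighborhood G y \<times> UNIV))
      * (max_degree H)\<^sup>2"
proof -
  interpret G: pair_graph G by fact
  interpret H: pair_graph H by fact
  let ?N = "open_neighborhood H"
  define Dx where "Dx = D \<inter> open_neighborhood G x \<times> UNIV"
  define Dy where "Dy = D \<inter> open_neighborhood G y \<times> UNIV"
  define tails where "tails = (\<lambda>d :: 'a \<times> 'b. Sigma (?N (snd d)) ?N)"
  define heads where "heads = (\<lambda>d :: 'a \<times> 'b. prod.swap ` tails d)"
  have card_tails: "card (tails d) \<le> (max_degree H)\<^sup>2" for d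
    unfolding tails_def by (rule H.card_walks_length_two_le)
  have card_heads: "card (heads d) \<le> (max_degree H)\<^sup>2" for d
    using card_tails[of d] unfolding heads_def by (simp add: card_image)
  have fin: "finite (tails d)" "finite (heads d)" for d
    by (simp_all add: heads_def tails_def H.finite_open_neighborhood)
  have finD: "finite Dx" "finite Dy"
    using D(2) by (simp_all add: Dx_def Dy_def)
  have yx: "(y, x) \<in> parcs G"
    using G.open_neighborhood_sym[of y x] xy by (simp add: open_neighborhood_def)
  have cover: "parcs H \<subseteq> (\<Union>d\<in>Dx. tails d) \<union> (\<Union>d\<in>Dy. heads d)"
  proof
    fix a assume "a \<in> parcs H"
    then obtain h h' where a: "a = (h, h')" and hh': "(h, h') \<in> parcs H"
      by (cases a) auto
    then have h'h: "(h', h) \<in> parcs H"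
      using H.open_neighborhood_sym[of h' h] by (simp add: open_neighborhood_def)
    have "((x, h), (y, h')) \<in> parcs (direct_product G H)"
      using xy hh' by (simp add: direct_product_def)
    from isolating_set_meets_arc[OF pair_graph_direct_product[OF assms(1,2)] D(1) this]
    consider "(x, h) \<in> D" | "(y, h') \<in> D"
      | g k where "(g, k) \<in> D" "(g, x) \<in> parcs G" "(k, h) \<in> parcs H"
      | g k where "(g, k) \<in> D" "(g, y) \<in> parcs G" "(k, h') \<in> parcs H"
      by (auto simp: closed_neighborhood_def open_neighborhood_def direct_product_def)
    then show "a \<in> (\<Union>d\<in>Dx. tails d) \<union> (\<Union>d\<in>Dy. heads d)"
    proof cases
      \<comment> \<open>An end of the edge that is in \<open>D\<close> lies over the neighbourhood of the other end's
        \<open>G\<close>-coordinate and dominates that other end, so it is charged there.\<close>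
      case 1
      then have "(x, h) \<in> Dy"
        using yx by (simp add: Dy_def open_neighborhood_def)
      moreover have "a \<in> heads (x, h)"
        using hh' h'h by (auto simp: heads_def tails_def a open_neighborhood_def image_iff)
      ultimately show ?thesis by blast
    next
      case 2
      then have "(y, h') \<in> Dx"
        using xy by (simp add: Dx_def open_neighborhood_def)
      moreover have "a \<in> tails (y, h')"
        using hh' h'h by (simp add: tails_def a open_neighborhood_def)
      ultimately show ?thesis by blast
    next
      case (3 g k)
      then have "(g, k) \<in> Dx"
        using G.open_neighborhood_sym[of g x] by (simp add: Dx_def open_neighborhood_def)
      moreover have "a \<in> tails (g, k)"
        using hh' 3 by (simp add: tails_def a open_neighborhood_def)
      ultimately show ?thesis by blast
    next
      case (4 g k)
      then have "(g, k) \<in> Dy"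
        using G.open_neighborhood_sym[of g y] by (simp add: Dy_def open_neighborhood_def)
      moreover have "a \<in> heads (g, k)"
        using h'h 4 by (auto simp: heads_def tails_def a open_neighborhood_def image_iff)
      ultimately show ?thesis by blast
    qed
  qed
  have "card (parcs H) \<le> card ((\<Union>d\<in>Dx. tails d) \<union> (\<Union>d\<in>Dy. heads d))"
    using cover finD fin by (intro card_mono) auto
  also have "\<dots> \<le> card (\<Union>d\<in>Dx. tails d) + card (\<Union>d\<in>Dy. heads d)"
    by (rule card_Un_le)
  also have "\<dots> \<le> (\<Sum>d\<in>Dx. card (tails d)) + (\<Sum>d\<in>Dy. card (heads d))"
    using finD by (intro add_mono card_UN_le)
  also have "\<dots> \<le> (\<Sum>d\<in>Dx. (max_degree H)\<^sup>2) + (\<Sum>d\<in>Dy. (max_degree H)\<^sup>2)"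
    by (intro add_mono sum_mono card_tails card_heads)
  also have "\<dots> = (card Dx + card Dy) * (max_degree H)\<^sup>2"
    by (simp add: add_mult_distrib)
  finally show ?thesis
    unfolding card_parcs_eq_twice_card_edges[OF assms(2)] Dx_def Dy_def .
qed

lemma open_packing_sum_layers_le:
  assumes "open_packing G P" "finite P" "finite D"
  shows "(\<Sum>x\<in>P. card (D \<inter> open_neighborhood G x \<times> UNIV)) \<le> card D"
proof -
  have "(\<Sum>x\<in>P. card (D \<inter> open_neighborhood G x \<times> UNIV)) =
      card (\<Union>x\<in>P. D \<inter> open_neighborhood G x \<times> UNIV)"
    using assms by (subst card_UN_disjoint) (auto simp: open_packing_def)
  also have "\<dots> \<le> card D"
    using assms(3) by (intro card_mono) auto
  finally show ?thesis .
qed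

theorem theorem3p5:
  fixes G :: "'a pair_pre_digraph" and H :: "'b pair_pre_digraph"
  assumes "pair_graph G" and "pair_graph H"
    and "\<exists>P. maximum_open_packing G P \<and> induces_matching G P"
    and "edges H \<noteq> {}"
  shows "real (isolation_number (direct_product G H)) \<ge>
    real (open_packing_number G) / 2 *
    real_of_int \<lceil>2 * real (card (edges H)) / (real (max_degree H))\<^sup>2\<rceil>"
proof -
  interpret G: pair_graph G by fact
  interpret H: pair_graph H by fact
  interpret GH: pair_graph "direct_product G H"
    using assms(1,2) by (rule pair_graph_direct_product)
  let ?N = "open_neighborhood G"
  let ?c = "\<lceil>2 * real (card (edges H)) / (real (max_degree H))\<^sup>2\<rceil>"
  obtain P where P: "open_packing G P" "card P = open_packing_number G" "induces_matching G P"
    using assms(3) by (auto simp: maximum_open_packing_def)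
  have finP: "finite P"
    using P(1) finite_subset[OF _ G.pair_finite_verts] by (auto simp: open_packing_def)
  obtain D where D: "isolating_set (direct_product G H) D"
      "card D = isolation_number (direct_product G H)"
    using isolation_number_attained[OF GH.pair_graph_axioms] by blast
  have finD: "finite D"
    using D(1) finite_subset[OF _ GH.pair_finite_verts] by (auto simp: isolating_set_def)
  define partner where "partner = (\<lambda>x. THE y. y \<in> P \<and> y \<in> ?N x)"
  have partner: "partner x \<in> P" "partner x \<in> ?N x" if "x \<in> P" for x
    using theI'[OF induces_matching_ex1_partner[OF P(3) that]] by (auto simp: partner_def)
  have partner_partner: "partner (partner x) = x" if "x \<in> P" for x
    using induces_matching_ex1_partner[OF P(3), of "partner x"] partner[OF that]
      partner[of "partner x"] that G.open_neighborhood_sym[of x "partner x"] by blast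
  have bij: "bij_betw partner P P"
    by (rule bij_betw_byWitness[where f' = partner]) (auto simp: partner partner_partner)
  define layer where "layer = (\<lambda>x. card (D \<inter> ?N x \<times> UNIV))"
  have maxdeg: "max_degree H > 0"
  proof -
    obtain u v where "(u, v) \<in> parcs H"
      using assms(4) by (auto simp: edges_def)
    then have "?thesis \<or> card (open_neighborhood H u) = 0"
      using H.card_open_neighborhood_le_max_degree[of u] by auto
    with \<open>(u, v) \<in> parcs H\<close> show ?thesis
      using H.finite_open_neighborhood[of u] by (auto simp: open_neighborhood_def)
  qed
  have bound: "?c \<le> int (layer x + layer (partner x))" if "x \<in> P" for x
  proof -
    have "2 * card (edges H) \<le> (layer x + layer (partner x)) * (max_degree H)\<^sup>2"
      using matched_layers_bound[OF assms(1,2) D(1) finD, of x "partner x"] partner(2)[OF that]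
      unfolding layer_def by (simp add: open_neighborhood_def)
    then have "2 * real (card (edges H)) \<le>
        real (layer x + layer (partner x)) * (real (max_degree H))\<^sup>2"
      by (metis of_nat_le_iff of_nat_mult of_nat_numeral of_nat_power)
    with maxdeg show ?thesis
      by (simp add: ceiling_le_iff pos_divide_le_eq)
  qed
  have "int (card P) * ?c \<le> (\<Sum>x\<in>P. int (layer x + layer (partner x)))"
    using sum_mono[of P "\<lambda>_. ?c"] bound by simp
  also have "\<dots> = int ((\<Sum>x\<in>P. layer x) + (\<Sum>x\<in>P. layer (partner x)))"
    by (simp add: sum.distrib)
  also have "\<dots> = 2 * int (\<Sum>x\<in>P. layer x)"
    by (simp add: sum.reindex_bij_betw[OF bij])
  also have "\<dots> \<le> 2 * int (card D)"
    using open_packing_sum_layers_le[OF P(1) finP finD] unfolding layer_def by linarith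
  finally have "real_of_int (int (card P) * ?c) \<le> real_of_int (2 * int (card D))"
    by (simp only: of_int_le_iff)
  then show ?thesis
    using P(2) D(2) by simp
qed

end
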